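(* Let $V$ be a finite-dimensional vector space over a field $\mathbb{F}$. Let $\mathcal{V}$ be a nilpotent linear subspace of $\operatorname{End}(V)$ such that $|\mathbb{F}| \geq \operatorname{ind}(\mathcal{V})$. Let $x \in \mathcal{V}^\bullet \setminus \{0\}$ be such that $$K(\mathcal{V}) \subset \mathbb{F} x \oplus \mathcal{V} x.$$ Then, $\mathcal{V} x=\{0\}$.
   Context: The field $\mathbb{F}$ is arbitrary (any characteristic). A linear subspace of $\operatorname{End}(V)$ is nilpotent when all its elements are nilpotent. The nilindex of a nilpotent endomorphism $u$ is the least non-negative integer $k$ such that $u^k=0$. For a nilpotent linear subspace $\mathcal{V}$ of $\operatorname{End}(V)$ (with $V\neq\{0\}$), the generic nilindex $\operatorname{ind}(\mathcal{V})$ is the greatest nilindex among the elements of $\mathcal{V}$; with $p:=\operatorname{ind}(\mathcal{V})$, one sets $\mathcal{V}^\bullet:=\bigcup_{v \in \mathcal{V}} \operatorname{Im} v^{p-1}$ and $K(\mathcal{V}):=\operatorname{span}(\mathcal{V}^\bullet)$ (with $v^0=\mathrm{id}_V$). For $x \in V$, $\mathcal{V}x:=\{v(x) \mid v \in \mathcal{V}\}$. For $x\neq 0$ the subspaces $\mathbb{F}x$ and $\mathcal{V}x$ are linearly disjoint, since all elements of $\mathcal{V}$ are nilpotent. *)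

theory Defs
  imports Complex_Main "HOL-Library.Function_Algebras"
begin

text \<open>
  The space \<open>V\<close> is the whole type \<open>'b\<close>, with scalar multiplication \<open>scale\<close> over the field \<open>'a\<close>.
  The powers of an endomorphism are its iterates \<open>u ^^ k\<close> (with \<open>u ^^ 0 = id\<close>), not the pointwise
  powers that come with the algebraic structure on functions.
\<close>

definition endomorphisms :: "('a::field \<Rightarrow> 'b::ab_group_add \<Rightarrow> 'b) \<Rightarrow> ('b \<Rightarrow> 'b) set" where
  "endomorphisms scale = {u. Vector_Spaces.linear scale scale u}"

definition fun_scale :: "('a \<Rightarrow> 'b \<Rightarrow> 'b) \<Rightarrow> 'a \<Rightarrow> ('b \<Rightarrow> 'b) \<Rightarrow> 'b \<Rightarrow> 'b" where
  "fun_scale scale c u = (\<lambda>x. scale c (u x))"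

lemma vector_space_fun_scale:
  assumes "vector_space scale"
  shows "vector_space (fun_scale scale)"
proof -
  interpret vector_space scale by fact
  show ?thesis
    by unfold_locales (auto simp: fun_scale_def fun_eq_iff scale_right_distrib scale_left_distrib)
qed

definition nilpotent :: "('b::zero \<Rightarrow> 'b) \<Rightarrow> bool" where
  "nilpotent u \<longleftrightarrow> (\<exists>k. u ^^ k = (\<lambda>_. 0))"

definition nilindex :: "('b::zero \<Rightarrow> 'b) \<Rightarrow> nat" where
  "nilindex u = (LEAST k. u ^^ k = (\<lambda>_. 0))"

definition nilpotent_subspace ::
    "('a::field \<Rightarrow> 'b::ab_group_add \<Rightarrow> 'b) \<Rightarrow> ('b \<Rightarrow> 'b) set \<Rightarrow> bool" where
  "nilpotent_subspace scale \<V> \<longleftrightarrow>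
     \<V> \<subseteq> endomorphisms scale \<and> module.subspace (fun_scale scale) \<V> \<and> (\<forall>v\<in>\<V>. nilpotent v)"

text \<open>
  The maximum is meaningful in finite dimension, where the nilindices are bounded by the dimension.
\<close>

definition generic_nilindex :: "('b::zero \<Rightarrow> 'b) set \<Rightarrow> nat" where
  "generic_nilindex \<V> = Max (nilindex ` \<V>)"

definition bullet :: "('b::zero \<Rightarrow> 'b) set \<Rightarrow> 'b set" where
  "bullet \<V> = (\<Union>v\<in>\<V>. range (v ^^ (generic_nilindex \<V> - 1)))"

definition K_space :: "('a::field \<Rightarrow> 'b::ab_group_add \<Rightarrow> 'b) \<Rightarrow> ('b \<Rightarrow> 'b) set \<Rightarrow> 'b set" where
  "K_space scale \<V> = module.span scale (bullet \<V>)"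

definition orbit_at :: "('b \<Rightarrow> 'b) set \<Rightarrow> 'b \<Rightarrow> 'b set" where
  "orbit_at \<V> x = {v x | v. v \<in> \<V>}"

text \<open>
  The sum of the line through \<open>x\<close> and \<open>\<V> x\<close> is automatically direct, so directness need not be
  required separately.
\<close>

lemma line_orbit_disjoint:
  assumes "vector_space scale" "nilpotent_subspace scale \<V>" "x \<noteq> 0"
  shows "module.span scale {x} \<inter> orbit_at \<V> x = {0}"
proof -
  interpret vector_space scale by fact
  interpret E: vector_space "fun_scale scale"
    by (rule vector_space_fun_scale) (fact assms(1))
  have "0 \<in> \<V>"
    using assms(2) by (auto simp: nilpotent_subspace_def intro: E.subspace_0)
  hence "0 \<in> orbit_at \<V> x"
    unfolding orbit_at_def by (auto intro!: exI[of _ 0])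
  moreover have "y = 0" if y: "y \<in> span {x}" "y \<in> orbit_at \<V> x" for y
  proof -
    from y(2) obtain v where v1: "v \<in> \<V>" "y = v x"
      by (auto simp: orbit_at_def)
    from y(1) obtain c where "y = scale c x"
      by (auto simp: span_singleton)
    with v1 have v: "v \<in> \<V>" "y = v x" "v x = scale c x"
      by simp_all
    from v(1) assms(2) obtain k where lin: "Vector_Spaces.linear scale scale v"
      and k: "v ^^ k = (\<lambda>_. 0)"
      by (auto simp: nilpotent_subspace_def endomorphisms_def nilpotent_def)
    interpret l: Vector_Spaces.linear scale scale v by (fact lin)
    have "(v ^^ n) x = scale (c ^ n) x" for n
      by (induction n) (simp_all add: l.scale v(3) mult.commute)
    from this[of k] k have "scale (c ^ k) x = 0" by simp
    with assms(3) have "c = 0" by simp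
    with v show "y = 0" by simp
  qed
  ultimately show ?thesis by (auto simp: span_zero)
qed

end

theory Submission
  imports Defs
begin

text \<open>
  Let \<open>p\<close> be the generic nilindex, write \<open>x = u\<^sup>p\<^sup>-\<^sup>1 y\<close> with \<open>u\<close> in \<open>\<V>\<close>, and let \<open>v\<close> be in \<open>\<V>\<close>.
  Let \<open>W\<^sub>n\<close> be the coefficient of \<open>t\<close> in \<open>(u + t v)\<^sup>n\<close>, so that \<open>W\<^sub>p = u W\<^sub>p\<^sub>-\<^sub>1 + v u\<^sup>p\<^sup>-\<^sup>1\<close>.
  Since \<open>(u + t v)\<^sup>p = 0\<close> for all \<open>t\<close>, and the coefficients of degrees \<open>0\<close> and \<open>p\<close> vanish, comparing
  coefficients at the \<open>p - 1\<close> or more nonzero scalars gives \<open>W\<^sub>p = 0\<close>, whence \<open>v x = - u (W\<^sub>p\<^sub>-\<^sub>1 y)\<close>.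
  Since \<open>(u + t v)\<^sup>p\<^sup>-\<^sup>1 y\<close> always lies in \<open>K(\<V>)\<close>, so does \<open>W\<^sub>p\<^sub>-\<^sub>1 y\<close>, hence it has the form
  \<open>c x + w x\<close> with \<open>w\<close> in \<open>\<V>\<close>. As \<open>u x = 0\<close>, this yields \<open>v x = - u (w x)\<close>. Thus \<open>\<V>x \<subseteq> u(\<V>x)\<close>,
  and iterating, \<open>\<V>x \<subseteq> u\<^sup>p(\<V>x) = 0\<close>.
\<close>

section \<open>Expansion of a pencil of endomorphisms, and interpolation with vector
  coefficients\<close>

text \<open>
  \<open>pencil_coeff u v n k\<close> is the coefficient of \<open>t ^ k\<close> in the iterate \<open>(u + t v) ^^ n\<close>.
\<close>

fun pencil_coeff :: "('b::ab_group_add \<Rightarrow> 'b) \<Rightarrow> ('b \<Rightarrow> 'b) \<Rightarrow> nat \<Rightarrow> nat \<Rightarrow> 'b \<Rightarrow> 'b" where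
  "pencil_coeff u v 0 0 z = z"
| "pencil_coeff u v 0 (Suc k) z = 0"
| "pencil_coeff u v (Suc n) 0 z = u (pencil_coeff u v n 0 z)"
| "pencil_coeff u v (Suc n) (Suc k) z = u (pencil_coeff u v n (Suc k) z) + v (pencil_coeff u v n k z)"

lemma pencil_coeff_0: "pencil_coeff u v n 0 z = (u ^^ n) z"
  by (induction n) auto

lemma pencil_coeff_above:
  assumes "u 0 = 0" "v 0 = 0" "n < k"
  shows "pencil_coeff u v n k z = 0"
  using assms(3)
proof (induction n arbitrary: k)
  case 0
  thus ?case by (cases k) auto
next
  case (Suc n)
  thus ?case by (cases k) (auto simp: assms(1,2))
qed

lemma pencil_coeff_top:
  assumes "u 0 = 0" "v 0 = 0"
  shows "pencil_coeff u v n n z = (v ^^ n) z"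
  by (induction n) (auto simp: assms pencil_coeff_above)

context vector_space
begin

text \<open>On the left, \<open>u\<close> keeps the degree in \<open>t\<close> and
  \<open>t v\<close> raises it by one, matching the recursion of
  \<open>pencil_coeff\<close>.\<close>

lemma pencil_power:
  assumes u: "Vector_Spaces.linear scale scale u" and v: "Vector_Spaces.linear scale scale v"
  shows "((u + fun_scale scale t v) ^^ n) z = (\<Sum>k\<le>n. scale (t ^ k) (pencil_coeff u v n k z))"
proof (induction n)
  case 0
  show ?case by simp
next
  case (Suc n)
  interpret u: Vector_Spaces.linear scale scale u by (fact u)
  interpret v: Vector_Spaces.linear scale scale v by (fact v)
  let ?c = "pencil_coeff u v n"
  have "(\<Sum>k\<le>Suc n. scale (t ^ k) (pencil_coeff u v (Suc n) k z)) =
      u (?c 0 z) + (\<Sum>k\<le>n. scale (t ^ Suc k) (u (?c (Suc k) z)))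
        + (\<Sum>k\<le>n. scale (t ^ Suc k) (v (?c k z)))"
    by (subst sum.atMost_Suc_shift) (simp add: scale_right_distrib sum.distrib add.assoc)
  also have "u (?c 0 z) + (\<Sum>k\<le>n. scale (t ^ Suc k) (u (?c (Suc k) z))) =
      (\<Sum>k\<le>Suc n. scale (t ^ k) (u (?c k z)))"
    by (subst sum.atMost_Suc_shift) simp
  also have "\<dots> = u (\<Sum>k\<le>n. scale (t ^ k) (?c k z))"
    by (simp add: u.sum u.scale pencil_coeff_above u.zero v.zero)
  also have "(\<Sum>k\<le>n. scale (t ^ Suc k) (v (?c k z))) =
      scale t (v (\<Sum>k\<le>n. scale (t ^ k) (?c k z)))"
    by (simp add: v.sum v.scale scale_sum_right)
  finally show ?case
    by (simp only: funpow.simps o_apply plus_fun_def fun_scale_def Suc.IH[unfolded plus_fun_def fun_scale_def])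
qed

text \<open>A Vandermonde argument modulo \<open>S\<close>, done by division: for a node
  \<open>s\<close> in \<open>T\<close>, the remainder lies in \<open>S\<close>, and the quotient has
  lower degree and values in \<open>S\<close> at the other nodes. It serves below both for
  \<open>{0}\<close> and for \<open>K_space scale \<V>\<close>.\<close>

lemma coeffs_in_subspace:
  assumes "subspace S" "finite T" "n \<le> card T"
    and "\<And>t. t \<in> T \<Longrightarrow> (\<Sum>k<n. scale (t ^ k) (a k)) \<in> S"
    and "k < n"
  shows "a k \<in> S"
  using assms(2-)
proof (induction n arbitrary: T a k)
  case 0
  thus ?case by simp
next
  case (Suc n)
  from Suc.prems(2) have "T \<noteq> {}" by auto
  then obtain s where s: "s \<in> T" by auto
  \<comment> \<open>\<open>b\<close> is the quotient of the polynomial with coefficients \<open>a\<close> by \<open>t - s\<close>.\<close>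
  define b where "b k = (\<Sum>j<n - k. scale (s ^ j) (a (Suc k + j)))" for k
  have b_n: "b n = 0" by (simp add: b_def)
  have a_Suc: "a (Suc k) = b k - scale s (b (Suc k))" if "k < n" for k
  proof -
    from that have "n - k = Suc (n - Suc k)" by simp
    hence "b k = a (Suc k) + scale s (b (Suc k))"
      by (simp add: b_def sum.lessThan_Suc_shift scale_sum_right del: sum.lessThan_Suc)
    thus ?thesis by simp
  qed
  \<comment> \<open>The remainder of the division, that is, the value of the polynomial at
    \<open>s\<close>.\<close>
  define c where "c = a 0 + scale s (b 0)"
  \<comment> \<open>The division is carried out on partial sums; the last correction term vanishes
    at \<open>m = n\<close>, since \<open>b n = 0\<close>.\<close>
  have "(\<Sum>k<Suc m. scale (t ^ k) (a k)) =
      c + scale (t - s) (\<Sum>k<m. scale (t ^ k) (b k)) - scale (s * t ^ m) (b m)"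
    if "m \<le> n" for m t
    using that
  proof (induction m)
    case 0
    show ?case by (simp add: c_def)
  next
    case (Suc m)
    hence "(\<Sum>k<Suc (Suc m). scale (t ^ k) (a k)) =
        c + scale (t - s) (\<Sum>k<m. scale (t ^ k) (b k)) - scale (s * t ^ m) (b m)
          + scale (t ^ Suc m) (b m - scale s (b (Suc m)))"
      by (simp add: a_Suc)
    thus ?case
      by (simp add: scale_right_distrib scale_left_diff_distrib scale_right_diff_distrib
          algebra_simps)
  qed
  from this[of n] have division: "(\<Sum>k<Suc n. scale (t ^ k) (a k)) =
      c + scale (t - s) (\<Sum>k<n. scale (t ^ k) (b k))" for t
    by (simp add: b_n)
  have c: "c \<in> S"
    using Suc.prems(3)[OF s] unfolding division by simp
  have b: "b k \<in> S" if "k < n" for k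
  proof (rule Suc.IH[OF _ _ _ that])
    show "finite (T - {s})" "n \<le> card (T - {s})"
      using Suc.prems(1,2) s by auto
    fix t assume t: "t \<in> T - {s}"
    hence "c + scale (t - s) (\<Sum>k<n. scale (t ^ k) (b k)) \<in> S"
      using Suc.prems(3)[of t] unfolding division by simp
    hence "scale (t - s) (\<Sum>k<n. scale (t ^ k) (b k)) \<in> S"
      using subspace_diff[OF assms(1) _ c] by fastforce
    hence "scale (inverse (t - s)) (scale (t - s) (\<Sum>k<n. scale (t ^ k) (b k))) \<in> S"
      by (rule subspace_scale[OF assms(1)])
    thus "(\<Sum>k<n. scale (t ^ k) (b k)) \<in> S"
      using t by simp
  qed
  have b': "b k \<in> S" if "k \<le> n" for k
    using b[of k] that by (cases "k = n") (auto simp: b_n subspace_0[OF assms(1)])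
  show ?case
  proof (cases k)
    case 0
    have "c - scale s (b 0) \<in> S"
      by (intro subspace_diff subspace_scale assms(1) c b') simp
    thus ?thesis by (simp add: 0 c_def)
  next
    case (Suc j)
    with Suc.prems(4) show ?thesis
      by (auto simp: a_Suc intro!: subspace_diff subspace_scale assms(1) b')
  qed
qed

end

section \<open>Nilindices and the generic nilindex\<close>

lemma funpow_nilindex:
  assumes "nilpotent u"
  shows "u ^^ nilindex u = (\<lambda>_. 0)"
  using assms unfolding nilpotent_def nilindex_def by (rule LeastI_ex)

lemma funpow_eq_zero_mono:
  fixes u :: "'b::zero \<Rightarrow> 'b"
  assumes "u 0 = 0" "u ^^ m = (\<lambda>_. 0)" "m \<le> n"
  shows "u ^^ n = (\<lambda>_. 0)"
proof -
  have "(u ^^ k) 0 = 0" for k by (induction k) (auto simp: assms(1))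
  moreover have "u ^^ n = (u ^^ (n - m)) \<circ> (u ^^ m)"
    using assms(3) by (simp flip: funpow_add)
  ultimately show ?thesis by (simp add: assms(2) fun_eq_iff)
qed

context finite_dimensional_vector_space
begin

text \<open>Makes the set under \<open>Max\<close> in \<open>generic_nilindex\<close> finite, so
  that the maximum really bounds every nilindex.\<close>

lemma nilindex_le_dimension:
  assumes u: "Vector_Spaces.linear scale scale u" and nil: "nilpotent u"
  shows "nilindex u \<le> dimension"
proof -
  interpret u: Vector_Spaces.linear scale scale u by (fact u)
  have range_Suc: "range (u ^^ Suc k) = u ` range (u ^^ k)" for k by auto
  have sub: "subspace (range (u ^^ k))" for k
  proof (induction k)
    case 0
    show ?case by simp
  next
    case (Suc k)
    thus ?case unfolding range_Suc by (rule u.subspace_image)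
  qed
  have dec: "range (u ^^ Suc k) \<subseteq> range (u ^^ k)" for k
    by (auto simp: funpow_swap1)
  \<comment> \<open>The images of the iterates decrease strictly until they reach zero.\<close>
  have "dim (range (u ^^ k)) + k \<le> dimension \<or> u ^^ k = (\<lambda>_. 0)" for k
  proof (induction k)
    case 0
    show ?case by (simp add: dim_UNIV dimension_def)
  next
    case (Suc k)
    show ?case
    proof (cases "range (u ^^ Suc k) = range (u ^^ k)")
      case True
      \<comment> \<open>Once two consecutive images agree, the chain is stationary, and it ends at
        zero by nilpotency.\<close>
      have "range (u ^^ (j + k)) = range (u ^^ k)" for j
      proof (induction j)
        case (Suc j)
        have "range (u ^^ (Suc j + k)) = u ` range (u ^^ (j + k))"
          using range_Suc[of "j + k"] by simp
        also have "\<dots> = range (u ^^ k)"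
          unfolding Suc using True range_Suc[of k] by simp
        finally show ?case .
      qed simp
      from this[of "nilindex u"] have "range (u ^^ k) = range (u ^^ (nilindex u + k))" by simp
      also have "u ^^ (nilindex u + k) = (\<lambda>_. 0)"
        by (rule funpow_eq_zero_mono[where u = u, OF u.zero funpow_nilindex[OF nil]]) simp
      finally have "u ^^ k = (\<lambda>_. 0)" by (auto simp: fun_eq_iff)
      thus ?thesis using funpow_eq_zero_mono[where u = u, OF u.zero, of k "Suc k"] by simp
    next
      case False
      hence "dim (range (u ^^ Suc k)) < dim (range (u ^^ k))"
        using dec[of k] sub[of k] sub[of "Suc k"]
        by (intro dim_psubset) (simp only: span_eq_iff[THEN iffD2] psubset_eq, simp)
      thus ?thesis using Suc.IH funpow_eq_zero_mono[where u = u, OF u.zero, of k "Suc k"] by auto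
    qed
  qed
  from this[of dimension] have "u ^^ dimension = (\<lambda>_. 0)"
  proof
    assume "dim (range (u ^^ dimension)) + dimension \<le> dimension"
    hence "range (u ^^ dimension) \<subseteq> {0}" by (simp add: dim_eq_0)
    thus ?thesis by (auto simp: fun_eq_iff)
  qed
  thus ?thesis unfolding nilindex_def by (rule Least_le)
qed

lemma funpow_generic_nilindex:
  assumes "nilpotent_subspace scale \<V>" "v \<in> \<V>"
  shows "v ^^ generic_nilindex \<V> = (\<lambda>_. 0)"
proof -
  have *: "Vector_Spaces.linear scale scale w" "nilpotent w" if "w \<in> \<V>" for w
    using assms(1) that by (auto simp: nilpotent_subspace_def endomorphisms_def)
  interpret v: Vector_Spaces.linear scale scale v by (rule *) fact
  have "nilindex ` \<V> \<subseteq> {..dimension}"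
    using * nilindex_le_dimension by auto
  hence "nilindex v \<le> generic_nilindex \<V>"
    unfolding generic_nilindex_def using assms(2) by (auto intro: Max_ge finite_subset)
  thus ?thesis
    using funpow_eq_zero_mono[of v] funpow_nilindex v.zero *(2)[OF assms(2)] by blast
qed

end

theorem lemma2p5:
  fixes scale :: "'a::field \<Rightarrow> 'b::ab_group_add \<Rightarrow> 'b"
    and Basis :: "'b set"
    and \<V> :: "('b \<Rightarrow> 'b) set"
    and x :: 'b
  assumes "finite_dimensional_vector_space scale Basis"
    and "nilpotent_subspace scale \<V>"
    and "infinite (UNIV :: 'a set) \<or> generic_nilindex \<V> \<le> card (UNIV :: 'a set)"
    and "x \<in> bullet \<V> - {0}"
    and "K_space scale \<V> \<subseteq> {a + b | a b. a \<in> module.span scale {x} \<and> b \<in> orbit_at \<V> x}"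
  shows "orbit_at \<V> x = {0}"
proof -
  interpret finite_dimensional_vector_space scale Basis by fact
  interpret E: vector_space "fun_scale scale"
    by (rule vector_space_fun_scale) unfold_locales
  define p where "p = generic_nilindex \<V>"
  have lin: "Vector_Spaces.linear scale scale v" if "v \<in> \<V>" for v
    using assms(2) that by (auto simp: nilpotent_subspace_def endomorphisms_def)
  have sub: "E.subspace \<V>"
    using assms(2) by (simp add: nilpotent_subspace_def)
  have pow: "v ^^ p = (\<lambda>_. 0)" if "v \<in> \<V>" for v
    unfolding p_def using assms(2) that by (rule funpow_generic_nilindex)
  have zero: "v 0 = 0" if "v \<in> \<V>" for v
  proof -
    interpret v: Vector_Spaces.linear scale scale v by (rule lin) fact
    show ?thesis by (rule v.zero)
  qed
  have pencil: "u + fun_scale scale t v \<in> \<V>" if "u \<in> \<V>" "v \<in> \<V>" for u v t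
    using that by (intro E.subspace_add E.subspace_scale sub)
  from assms(4) obtain u y where u: "u \<in> \<V>" and x: "x = (u ^^ (p - 1)) y" and "x \<noteq> 0"
    by (auto simp: bullet_def p_def)
  interpret u: Vector_Spaces.linear scale scale u by (rule lin) fact
  have "p \<noteq> 0"
  proof
    assume "p = 0"
    with pow[OF u] have "x = 0" by (simp add: fun_eq_iff)
    with \<open>x \<noteq> 0\<close> show False ..
  qed
  then obtain q where q: "p = Suc q" by (cases p) auto
  have ux: "u x = 0"
    using pow[OF u] by (simp add: x q fun_eq_iff)
  \<comment> \<open>Having \<open>0\<close> in \<open>T\<close> leaves at least \<open>p - 1\<close>
    nonzero nodes for the first interpolation, while the second uses all of
    \<open>T\<close>.\<close>
  obtain T :: "'a set" where T: "finite T" "p \<le> card T" "0 \<in> T"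
  proof (cases "finite (UNIV :: 'a set)")
    case True
    thus ?thesis using assms(3) that[of UNIV] by (auto simp: p_def)
  next
    case False
    then obtain T :: "'a set" where "finite T" "card T = p"
      using infinite_arbitrarily_large by blast
    thus ?thesis using that[of "insert 0 T"] card_insert_le[of T 0] by simp
  qed
  have step: "orbit_at \<V> x \<subseteq> u ` orbit_at \<V> x"
  proof
    fix z assume "z \<in> orbit_at \<V> x"
    then obtain v where v: "v \<in> \<V>" and z: "z = v x" by (auto simp: orbit_at_def)
    let ?c = "pencil_coeff u v"
    have "?c p 1 y = 0"
    \<comment> \<open>If \<open>p = 1\<close>, degree 1 is already the top degree, so no middle
      coefficient is left to interpolate; but then every element of \<open>\<V>\<close> is
      zero.\<close>
    proof (cases q)
      case 0
      have "w y = 0" if "w \<in> \<V>" for w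
        using pow[OF that] by (simp add: q 0 fun_eq_iff)
      thus ?thesis using u v by (simp add: q 0 zero)
    next
      case (Suc r)
      have "?c p (Suc 0) y \<in> {0}"
      \<comment> \<open>Indices are shifted by one: the ends \<open>u ^^ p\<close> and
        \<open>v ^^ p\<close> vanish, and a factor \<open>t\<close> is cancelled.\<close>
      proof (rule coeffs_in_subspace[where T = "T - {0}" and n = q and a = "\<lambda>k. ?c p (Suc k) y"])
        show "q \<le> card (T - {0})" using T q by simp
        fix t assume t: "t \<in> T - {0}"
        have "0 = (\<Sum>k\<le>p. scale (t ^ k) (?c p k y))"
          using pencil_power[OF lin[OF u] lin[OF v], of p t y] pow[OF pencil[OF u v]] by simp
        also have "\<dots> = (\<Sum>k\<le>q. scale (t ^ Suc k) (?c p (Suc k) y))"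
          unfolding q by (subst sum.atMost_Suc_shift)
            (use pow[OF u] in \<open>simp add: pencil_coeff_0 q fun_eq_iff del: pencil_coeff.simps\<close>)
        also have "\<dots> = (\<Sum>k<q. scale (t ^ Suc k) (?c p (Suc k) y))"
          using pow[OF v] u v
          by (simp add: lessThan_Suc_atMost[symmetric] pencil_coeff_top zero q fun_eq_iff
              del: pencil_coeff.simps funpow.simps)
        also have "\<dots> = scale t (\<Sum>k<q. scale (t ^ k) (?c p (Suc k) y))"
          by (simp add: scale_sum_right)
        finally show "(\<Sum>k<q. scale (t ^ k) (?c p (Suc k) y)) \<in> {0}"
          using t by auto
      qed (use T Suc in auto)
      thus ?thesis by simp
    qed
    hence vx: "v x = - u (?c q 1 y)"
      by (simp add: q x pencil_coeff_0 eq_neg_iff_add_eq_0 add.commute)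
    have "?c q 1 y \<in> K_space scale \<V>"
    proof (cases q)
      case 0
      thus ?thesis by (simp add: K_space_def span_zero)
    next
      case (Suc r)
      show ?thesis
      \<comment> \<open>The degree is now at most \<open>q = p - 1\<close>, so \<open>p\<close>
        nodes suffice.\<close>
      proof (rule coeffs_in_subspace[where T = T and n = p and a = "\<lambda>k. ?c q k y"])
        show "subspace (K_space scale \<V>)" by (simp add: K_space_def)
        fix t
        have "((u + fun_scale scale t v) ^^ q) y \<in> bullet \<V>"
          using pencil[OF u v, of t] unfolding bullet_def p_def[symmetric] q by auto
        thus "(\<Sum>k<p. scale (t ^ k) (?c q k y)) \<in> K_space scale \<V>"
          using pencil_power[OF lin[OF u] lin[OF v], of q t y]
          by (simp add: K_space_def span_base q lessThan_Suc_atMost del: sum.lessThan_Suc)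
      qed (use T Suc q in auto)
    qed
    hence "?c q 1 y \<in> {a + b | a b. a \<in> span {x} \<and> b \<in> orbit_at \<V> x}"
      using assms(5) by (rule rev_subsetD)
    then obtain c w where w: "w \<in> \<V>" and c: "?c q 1 y = scale c x + w x"
      unfolding orbit_at_def span_singleton by blast
    have "z = u ((- w) x)"
      unfolding z vx c by (simp add: u.add u.scale ux u.neg)
    moreover have "- w \<in> \<V>" using sub w by (rule E.subspace_neg)
    ultimately show "z \<in> u ` orbit_at \<V> x" unfolding orbit_at_def by blast
  qed
  \<comment> \<open>Iterating the inclusion up to \<open>n = p\<close> is decisive, because
    \<open>u ^^ p\<close> is zero.\<close>
  have "orbit_at \<V> x \<subseteq> (u ^^ n) ` orbit_at \<V> x" for n
  proof (induction n)
    case (Suc n)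
    have "orbit_at \<V> x \<subseteq> u ` (u ^^ n) ` orbit_at \<V> x"
      using step image_mono[OF Suc, of u] by (rule order_trans)
    thus ?case by (simp add: image_comp)
  qed simp
  from this[of p] have "orbit_at \<V> x \<subseteq> {0}"
    by (auto simp: pow[OF u])
  moreover have "0 \<in> orbit_at \<V> x"
    using E.subspace_0[OF sub] by (auto simp: orbit_at_def intro!: exI[of _ 0])
  ultimately show ?thesis by auto
qed

end
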